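(* Let $Q$ be a basic sequence that is infinite in limit. Then $\operatorname{windim}\left(\mathbb R\setminus\mathscr{RN}_2(Q)\right)=1/2$. Moreover, if $Q$ is also $1$-divergent, then $\operatorname{windim}\left(\mathbb R\setminus\mathscr{N}_1(Q)\right)=1/2$.
   Context: A basic sequence is a sequence $Q=(q_n)_{n=1}^\infty$ of integers $q_n\ge 2$. It is infinite in limit if $q_n\to\infty$, and $1$-divergent if $\sum_{n=1}^\infty 1/q_n=\infty$. The $Q$-Cantor series expansion of $x\in\mathbb R$ is the unique expansion $x=\lfloor x\rfloor+\sum_{n=1}^\infty \frac{E_n}{q_1q_2\cdots q_n}$ with $E_n\in\{0,1,\dots,q_n-1\}$ for $n\ge1$ and $E_n\ne q_n-1$ for infinitely many $n$. For a block (finite sequence) $B$ of non-negative integers, $N_n^Q(B,x)$ is the number of times $B$ occurs in the digit sequence $(E_1,E_2,\dots)$ of $x$ starting at a position no greater than $n$. $\mathscr{RN}_2(Q)$ is the set of real $x$ such that for all blocks $B_1,B_2$ of length $2$, $\lim_{n\to\infty} N_n^Q(B_1,x)/N_n^Q(B_2,x)=1$. $\mathscr N_1(Q)$ is the set of real $x$ such that for every block $B$ of length $1$, $\lim_{n\to\infty}N_n^Q(B,x)/Q_n^{(1)}=1$, where $Q_n^{(1)}=\sum_{j=1}^n 1/q_j$. Schmidt's game: let $\alpha,\beta\in(0,1)$, $S\subseteq\mathbb R$, and let $\rho(I)$ denote the radius of a (bounded, nondegenerate) interval $I$. Bob first picks any closed interval $B_1$; Alice picks a closed interval $A_1\subset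 B_1$ with $\rho(A_1)=\alpha\rho(B_1)$; Bob picks a closed interval $B_2\subset A_1$ with $\rho(B_2)=\beta\rho(A_1)$; Alice picks a closed interval $A_2\subset B_2$ with $\rho(A_2)=\alpha\rho(B_2)$; and so on. $S$ is $(\alpha,\beta)$-winning if Alice can play so that $\bigcap_{n=1}^\infty B_n\subseteq S$; $S$ is $\alpha$-winning if it is $(\alpha,\beta)$-winning for all $0<\beta<1$. $\operatorname{windim} S$ is the supremum of all $\alpha\in(0,1)$ such that $S$ is $\alpha$-winning. *)

theory Defs
  imports "HOL-Analysis.Analysis"
begin

text \<open>Sequences are indexed from 1 on; the value of a basic sequence at 0 is never used.\<close>

definition basic_sequence :: "(nat \<Rightarrow> nat) \<Rightarrow> bool" where
  "basic_sequence Q \<longleftrightarrow> (\<forall>n\<ge>1. Q n \<ge> 2)"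

definition infinite_in_limit :: "(nat \<Rightarrow> nat) \<Rightarrow> bool" where
  "infinite_in_limit Q \<longleftrightarrow> filterlim Q at_top sequentially"

definition Qsum1 :: "(nat \<Rightarrow> nat) \<Rightarrow> nat \<Rightarrow> real" where
  "Qsum1 Q n = (\<Sum>j=1..n. 1 / real (Q j))"

definition one_divergent :: "(nat \<Rightarrow> nat) \<Rightarrow> bool" where
  "one_divergent Q \<longleftrightarrow> filterlim (Qsum1 Q) at_top sequentially"

text \<open>The condition \<^term>\<open>E 0 = (0::nat)\<close> only pins the unused position 0, so that the expansion is
  unique as a function on \<^typ>\<open>nat\<close>.\<close>

definition is_cantor_expansion :: "(nat \<Rightarrow> nat) \<Rightarrow> real \<Rightarrow> (nat \<Rightarrow> nat) \<Rightarrow> bool" where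
  "is_cantor_expansion Q x E \<longleftrightarrow>
     E 0 = 0 \<and>
     (\<forall>n\<ge>1. E n \<in> {0..Q n - 1}) \<and>
     infinite {n. n \<ge> 1 \<and> E n \<noteq> Q n - 1} \<and>
     (\<lambda>n. real (E (Suc n)) / (\<Prod>j=1..Suc n. real (Q j))) sums (x - of_int \<lfloor>x\<rfloor>)"

definition cantor_digits :: "(nat \<Rightarrow> nat) \<Rightarrow> real \<Rightarrow> nat \<Rightarrow> nat" where
  "cantor_digits Q x = (THE E. is_cantor_expansion Q x E)"

definition block_count :: "(nat \<Rightarrow> nat) \<Rightarrow> nat \<Rightarrow> nat list \<Rightarrow> real \<Rightarrow> nat" where
  "block_count Q n B x =
     card {i \<in> {1..n}. \<forall>j<length B. cantor_digits Q x (i + j) = B ! j}"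

text \<open>If \<open>B\<^sub>2\<close> never occurs, the quotient below is constantly 0 (division by zero), so the
  limit condition fails, as it should.\<close>

definition RN2 :: "(nat \<Rightarrow> nat) \<Rightarrow> real set" where
  "RN2 Q = {x. \<forall>B\<^sub>1 B\<^sub>2. length B\<^sub>1 = 2 \<and> length B\<^sub>2 = 2 \<longrightarrow>
     (\<lambda>n. real (block_count Q n B\<^sub>1 x) / real (block_count Q n B\<^sub>2 x)) \<longlonglongrightarrow> 1}"

definition N1 :: "(nat \<Rightarrow> nat) \<Rightarrow> real set" where
  "N1 Q = {x. \<forall>B. length B = 1 \<longrightarrow>
     (\<lambda>n. real (block_count Q n B x) / Qsum1 Q n) \<longlonglongrightarrow> 1}"

definition closed_interval :: "real set \<Rightarrow> bool" where
  "closed_interval I \<longleftrightarrow> (\<exists>a b. a < b \<and> I = {a..b})"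

definition radius :: "real set \<Rightarrow> real" where
  "radius I = diameter I / 2"

definition legal_move :: "real \<Rightarrow> real set \<Rightarrow> real set \<Rightarrow> bool" where
  "legal_move c I J \<longleftrightarrow> closed_interval J \<and> J \<subseteq> I \<and> radius J = c * radius I"

text \<open>A strategy \<open>\<sigma>\<close> for Alice maps the list of Bob's moves so far to her next move, so
  \<open>alice_move \<sigma> B n\<close> is her reply to \<open>B 0, \<dots>, B n\<close>. (The game is indexed from 0.)\<close>

definition alice_move :: "(real set list \<Rightarrow> real set) \<Rightarrow> (nat \<Rightarrow> real set) \<Rightarrow> nat \<Rightarrow> real set" where
  "alice_move \<sigma> B n = \<sigma> (map B [0..<Suc n])"

definition bob_legal_upto ::
  "real \<Rightarrow> (real set list \<Rightarrow> real set) \<Rightarrow> (nat \<Rightarrow> real set) \<Rightarrow> nat \<Rightarrow> bool" where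
  "bob_legal_upto \<beta> \<sigma> B n \<longleftrightarrow>
     closed_interval (B 0) \<and> (\<forall>k<n. legal_move \<beta> (alice_move \<sigma> B k) (B (Suc k)))"

text \<open>Alice has to answer legally at every position reached by legal moves of Bob; otherwise she
  could win vacuously by leaving Bob without a legal move.\<close>

definition winning2 :: "real \<Rightarrow> real \<Rightarrow> real set \<Rightarrow> bool" where
  "winning2 \<alpha> \<beta> S \<longleftrightarrow> (\<exists>\<sigma>. \<forall>B.
     (\<forall>n. bob_legal_upto \<beta> \<sigma> B n \<longrightarrow> legal_move \<alpha> (B n) (alice_move \<sigma> B n)) \<and>
     ((\<forall>n. bob_legal_upto \<beta> \<sigma> B n) \<longrightarrow> (\<Inter>n. B n) \<subseteq> S))"

definition winning :: "real \<Rightarrow> real set \<Rightarrow> bool" where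
  "winning \<alpha> S \<longleftrightarrow> (\<forall>\<beta>. 0 < \<beta> \<and> \<beta> < 1 \<longrightarrow> winning2 \<alpha> \<beta> S)"

definition windim :: "real set \<Rightarrow> real" where
  "windim S = Sup {\<alpha>. 0 < \<alpha> \<and> \<alpha> < 1 \<and> winning \<alpha> S}"

end

theory Submission
  imports Defs
begin

text \<open>Lower bound: a number with only finitely many digits 0 lies in neither normality set. Since
  \<open>Q\<close> tends to infinity, at every turn at most one digit position has the scale of the current
  interval, and the numbers with digit 0 there fill so small an interval that Alice, who has
  \<open>\<alpha> < 1/2\<close>, can avoid it by moving to the far left or to the far right.

  Upper bound: for \<open>\<alpha> > 1/2\<close> Bob can centre all his intervals at a point outside the target set,
  so only non-emptiness of the two normality sets is needed. It is witnessed by digit sequences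
  that restart a fixed pattern whenever the integer part of a slowly growing function jumps; digits
  exceeding \<open>Q n - 2\<close> are replaced by \<open>Q n - 2\<close>, which takes each value only finitely often.\<close>

section \<open>Cantor series expansions\<close>

definition digit_scale :: "(nat \<Rightarrow> nat) \<Rightarrow> nat \<Rightarrow> real" where
  "digit_scale Q n = (\<Prod>j=1..n. real (Q j))"

lemma digit_scale_0 [simp]: "digit_scale Q 0 = 1"
  by (simp add: digit_scale_def)

lemma digit_scale_Suc: "digit_scale Q (Suc n) = digit_scale Q n * real (Q (Suc n))"
  by (simp add: digit_scale_def)

lemma basic_sequence_Suc: "basic_sequence Q \<Longrightarrow> Q (Suc n) \<ge> 2"
  by (simp add: basic_sequence_def)

lemma digit_scale_ge:
  assumes "basic_sequence Q"
  shows "digit_scale Q n \<ge> 2 ^ n"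
proof (induction n)
  case (Suc n)
  have "digit_scale Q n * real (Q (Suc n)) \<ge> 2 ^ n * 2"
    using Suc basic_sequence_Suc[OF assms, of n] by (intro mult_mono) (auto intro: order_trans[rotated])
  then show ?case by (simp add: digit_scale_Suc mult.commute)
qed simp

lemma digit_scale_pos: "basic_sequence Q \<Longrightarrow> digit_scale Q n > 0"
  using digit_scale_ge[of Q n] by (meson less_le_trans zero_less_numeral zero_less_power)

lemma inverse_digit_scale_tendsto_0:
  assumes "basic_sequence Q"
  shows "(\<lambda>n. 1 / digit_scale Q n) \<longlonglongrightarrow> 0"
proof (rule tendsto_sandwich[OF _ _ tendsto_const])
  show "(\<lambda>n. (1/2) ^ n :: real) \<longlonglongrightarrow> 0" by (rule LIMSEQ_power_zero) simp
  show "\<forall>\<^sub>F n in sequentially. 0 \<le> 1 / digit_scale Q n"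
    using digit_scale_pos[OF assms] by (intro always_eventually) (simp add: less_imp_le)
  show "\<forall>\<^sub>F n in sequentially. 1 / digit_scale Q n \<le> (1/2) ^ n"
    using digit_scale_ge[OF assms] digit_scale_pos[OF assms]
    by (intro always_eventually allI) (simp add: power_divide frac_le)
qed

text \<open>The numerator of the n-th partial sum over the denominator
  \<open>digit_scale Q n\<close>, by Horner's scheme. It turns questions about digits into questions
  about floors.\<close>

primrec digit_prefix :: "(nat \<Rightarrow> nat) \<Rightarrow> (nat \<Rightarrow> nat) \<Rightarrow> nat \<Rightarrow> nat" where
  "digit_prefix Q E 0 = 0"
| "digit_prefix Q E (Suc n) = digit_prefix Q E n * Q (Suc n) + E (Suc n)"

lemma digit_partial_sum:
  assumes "basic_sequence Q"
  shows "(\<Sum>k<n. real (E (Suc k)) / digit_scale Q (Suc k)) = real (digit_prefix Q E n) / digit_scale Q n"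
proof (induction n)
  case (Suc n)
  then show ?case
    using digit_scale_pos[OF assms, of n] basic_sequence_Suc[OF assms, of n]
    by (simp add: digit_scale_Suc field_simps)
qed simp

text \<open>The partial sums \<open>s n\<close> increase, while
  \<open>s n + 1 / digit_scale Q n\<close> decreases because digits are at most
  \<open>Q n - 1\<close>; \<open>y\<close> is squeezed between them.\<close>

lemma digit_series_bounds:
  assumes Q: "basic_sequence Q"
    and E: "\<And>n. n \<ge> 1 \<Longrightarrow> E n \<in> {0..Q n - 1}"
    and inf: "infinite {n. n \<ge> 1 \<and> E n \<noteq> Q n - 1}"
    and y: "(\<lambda>n. real (E (Suc n)) / digit_scale Q (Suc n)) sums y"
  shows "real (digit_prefix Q E n) \<le> digit_scale Q n * y"
    and "digit_scale Q n * y < real (digit_prefix Q E n) + 1"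
proof -
  define s where "s n = (\<Sum>k<n. real (E (Suc k)) / digit_scale Q (Suc k))" for n
  note pos = digit_scale_pos[OF Q]
  have s_lim: "s \<longlonglongrightarrow> y" using y by (simp add: sums_def s_def[abs_def])
  have s_Suc: "s (Suc n) = s n + real (E (Suc n)) / digit_scale Q (Suc n)" for n
    by (simp add: s_def)
  have telescope: "1 / digit_scale Q n = real (Q (Suc n)) / digit_scale Q (Suc n)" for n
    using pos[of n] basic_sequence_Suc[OF Q, of n] by (simp add: digit_scale_Suc)
  have E_le: "real (E (Suc n)) + 1 \<le> real (Q (Suc n))" for n
    using E[of "Suc n"] basic_sequence_Suc[OF Q, of n] by simp
  have incr: "s n \<le> s m" if "n \<le> m" for m n
    using that unfolding s_def
    by (intro sum_mono2) (auto simp: less_imp_le[OF pos])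
  have decr: "s m + 1 / digit_scale Q m \<le> s n + 1 / digit_scale Q n" if "n \<le> m" for m n
    using that
  proof (induction m rule: dec_induct)
    case (step m)
    have "(real (E (Suc m)) + 1) / digit_scale Q (Suc m) \<le> real (Q (Suc m)) / digit_scale Q (Suc m)"
      using E_le pos by (intro divide_right_mono) (auto simp: less_imp_le)
    then show ?case using step telescope[of m] by (simp add: s_Suc add_divide_distrib)
  qed simp
  have ps: "digit_scale Q n * s n = real (digit_prefix Q E n)"
    using digit_partial_sum[OF Q, of E n] pos[of n] by (simp add: s_def)
  have "s n \<le> y"
    by (rule tendsto_lowerbound[OF s_lim]) (auto intro!: eventually_sequentiallyI incr)
  then show "real (digit_prefix Q E n) \<le> digit_scale Q n * y"
    using pos[of n] ps by (metis mult_le_cancel_left_pos)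
  \<comment> \<open>At a non-maximal digit the decreasing upper bound loses at least a further
    \<open>1 / digit_scale Q m\<close>, for good. This makes the inequality strict.\<close>
  obtain m where m: "m > n" "E m \<noteq> Q m - 1"
    using inf by (auto simp: infinite_nat_iff_unbounded)
  then obtain l where l: "m = Suc l" "n \<le> l" by (cases m) auto
  have "real (E (Suc l)) + 2 \<le> real (Q (Suc l))"
    using E[of "Suc l"] basic_sequence_Suc[OF Q, of l] m(2) l by simp
  then have "(real (E (Suc l)) + 2) / digit_scale Q (Suc l) \<le> real (Q (Suc l)) / digit_scale Q (Suc l)"
    using pos by (intro divide_right_mono) (auto simp: less_imp_le)
  then have strict: "s m + 2 / digit_scale Q m \<le> s n + 1 / digit_scale Q n"
    using decr[OF l(2)] telescope[of l] l by (simp add: s_Suc add_divide_distrib)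
  have "s k \<le> s n + 1 / digit_scale Q n - 1 / digit_scale Q m" if "k \<ge> m" for k
    using decr[OF that] strict pos[of k] by (smt (verit) divide_pos_pos add_divide_distrib)
  then have "y \<le> s n + 1 / digit_scale Q n - 1 / digit_scale Q m"
    by (intro tendsto_upperbound[OF s_lim]) (auto intro!: eventually_sequentiallyI)
  also have "\<dots> < s n + 1 / digit_scale Q n" using pos[of m] by simp
  finally have "digit_scale Q n * y < digit_scale Q n * (s n + 1 / digit_scale Q n)"
    using pos[of n] by simp
  then show "digit_scale Q n * y < real (digit_prefix Q E n) + 1"
    using ps pos[of n] by (simp add: distrib_left)
qed

section \<open>Uniqueness and existence of the expansion\<close>

lemma cantor_expansion_prefix:
  assumes Q: "basic_sequence Q" and E: "is_cantor_expansion Q x E"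
  shows "int (digit_prefix Q E n) = \<lfloor>digit_scale Q n * frac x\<rfloor>"
proof -
  have "(\<lambda>n. real (E (Suc n)) / digit_scale Q (Suc n)) sums frac x"
    using E by (simp add: is_cantor_expansion_def digit_scale_def frac_def)
  from digit_series_bounds[OF Q _ _ this, of n] E show ?thesis
    by (simp add: is_cantor_expansion_def eq_commute[of "int _"] floor_eq_iff)
qed

lemma cantor_expansion_unique:
  assumes Q: "basic_sequence Q" and E: "is_cantor_expansion Q x E" and E': "is_cantor_expansion Q x E'"
  shows "E = E'"
proof
  fix n
  have "digit_prefix Q E m = digit_prefix Q E' m" for m
    using cantor_expansion_prefix[OF Q E, of m] cantor_expansion_prefix[OF Q E', of m] by simp
  from this[of n] this[of "n - 1"] show "E n = E' n"
    using E E' by (cases n) (auto simp: is_cantor_expansion_def)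
qed

lemma cantor_expansion_exists:
  assumes Q: "basic_sequence Q"
  shows "\<exists>E. is_cantor_expansion Q x E"
proof -
  define y where "y = frac x"
  define I where "I n = \<lfloor>digit_scale Q n * y\<rfloor>" for n
  define E where "E n = (if n = 0 then 0 else nat (I n - int (Q n) * I (n - 1)))" for n
  note pos = digit_scale_pos[OF Q]
  have y: "0 \<le> y" "y < 1" by (auto simp: y_def frac_lt_1)
  have E_bound: "0 \<le> I (Suc n) - int (Q (Suc n)) * I n"
    "I (Suc n) - int (Q (Suc n)) * I n < int (Q (Suc n))" for n
  proof -
    let ?q = "int (Q (Suc n))"
    have q: "real_of_int ?q > 0" using basic_sequence_Suc[OF Q, of n] by simp
    have l: "real_of_int (I n) \<le> digit_scale Q n * y"
      and u: "digit_scale Q n * y < real_of_int (I n) + 1"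
      unfolding I_def by linarith+
    have e: "digit_scale Q (Suc n) * y = digit_scale Q n * y * real_of_int ?q"
      by (simp add: digit_scale_Suc)
    have "real_of_int (I n * ?q) \<le> digit_scale Q (Suc n) * y"
      unfolding e of_int_mult using l q by (intro mult_right_mono) auto
    then have "I n * ?q \<le> I (Suc n)" unfolding I_def[of "Suc n"] by (simp only: le_floor_iff)
    then show "0 \<le> I (Suc n) - ?q * I n" by (simp add: mult.commute)
    have "digit_scale Q (Suc n) * y < real_of_int ((I n + 1) * ?q)"
      unfolding e of_int_mult using u q by (intro mult_strict_right_mono) auto
    then have "I (Suc n) < (I n + 1) * ?q" unfolding I_def[of "Suc n"] by (simp only: floor_less_iff)
    then show "I (Suc n) - ?q * I n < ?q" by (simp add: algebra_simps)
  qed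
  have E_Suc: "int (E (Suc n)) = I (Suc n) - int (Q (Suc n)) * I n" for n
    using E_bound[of n] by (simp add: E_def)
  have I0: "I 0 = 0" using y by (simp add: I_def floor_eq_iff)
  have I_prefix: "I n = int (digit_prefix Q E n)" for n
    by (induction n) (use E_Suc I0 in \<open>simp_all add: mult.commute\<close>)
  have lim: "(\<lambda>n. real_of_int (I n) / digit_scale Q n) \<longlonglongrightarrow> y"
  proof (rule tendsto_sandwich[OF _ _ _ tendsto_const])
    show "(\<lambda>n. y - 1 / digit_scale Q n) \<longlonglongrightarrow> y"
      using tendsto_diff[OF tendsto_const inverse_digit_scale_tendsto_0[OF Q], of y] by simp
    have "real_of_int (I n) \<le> digit_scale Q n * y" "digit_scale Q n * y < real_of_int (I n) + 1" for n
      unfolding I_def by linarith+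
    then show "\<forall>\<^sub>F n in sequentially. y - 1 / digit_scale Q n \<le> real_of_int (I n) / digit_scale Q n"
      and "\<forall>\<^sub>F n in sequentially. real_of_int (I n) / digit_scale Q n \<le> y"
      using pos by (auto intro!: always_eventually simp: field_simps less_imp_le
          simp flip: add_divide_distrib)
  qed
  have sums: "(\<lambda>n. real (E (Suc n)) / digit_scale Q (Suc n)) sums y"
    unfolding sums_def digit_partial_sum[OF Q] using lim by (simp add: I_prefix)
  have "infinite {n. n \<ge> 1 \<and> E n \<noteq> Q n - 1}"
  proof
    assume "finite {n. n \<ge> 1 \<and> E n \<noteq> Q n - 1}"
    then obtain N where N: "\<And>n. n \<ge> 1 \<Longrightarrow> E n \<noteq> Q n - 1 \<Longrightarrow> n \<le> N"
      unfolding finite_nat_set_iff_bounded_le by blast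
    \<comment> \<open>If all digits beyond \<open>N\<close> were maximal, the upper endpoints
      \<open>(I n + 1) / digit_scale Q n\<close> would be constant from \<open>N\<close> on. As they
      tend to \<open>y\<close>, they would equal \<open>y\<close>, which the strict floor inequality
      excludes.\<close>
    have carry: "real_of_int (I (Suc n)) + 1 = (real_of_int (I n) + 1) * real (Q (Suc n))" if "n \<ge> N" for n
    proof -
      have "E (Suc n) = Q (Suc n) - 1" using N[of "Suc n"] that by force
      then have "I (Suc n) + 1 = (I n + 1) * int (Q (Suc n))"
        using E_Suc[of n] basic_sequence_Suc[OF Q, of n] by (simp add: algebra_simps of_nat_diff)
      then show ?thesis by (metis of_int_1 of_int_add of_int_mult of_int_of_nat_eq)
    qed
    define c where "c = (real_of_int (I N) + 1) / digit_scale Q N"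
    have const: "(real_of_int (I n) + 1) / digit_scale Q n = c" if "n \<ge> N" for n
      using that
    proof (induction n rule: dec_induct)
      case (step n)
      then show ?case
        using carry[of n] basic_sequence_Suc[OF Q, of n] by (simp add: digit_scale_Suc)
    qed (simp add: c_def)
    have "(\<lambda>n. real_of_int (I n) / digit_scale Q n + 1 / digit_scale Q n) \<longlonglongrightarrow> y + 0"
      by (intro tendsto_add lim inverse_digit_scale_tendsto_0 Q)
    moreover have "\<forall>\<^sub>F n in sequentially. real_of_int (I n) / digit_scale Q n + 1 / digit_scale Q n = c"
      using const by (auto intro!: eventually_sequentiallyI[of N] simp: add_divide_distrib)
    ultimately have "(\<lambda>_::nat. c) \<longlonglongrightarrow> y" using tendsto_cong by fastforce
    then have "c = y" by (simp add: LIMSEQ_const_iff)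
    moreover have "digit_scale Q N * y < real_of_int (I N) + 1" unfolding I_def by linarith
    ultimately show False using pos[of N] by (simp add: c_def field_simps)
  qed
  moreover have "E n \<in> {0..Q n - 1}" if "n \<ge> 1" for n
    using that E_Suc[of "n - 1"] E_bound[of "n - 1"] by (cases n) auto
  ultimately have "is_cantor_expansion Q x E"
    using sums by (simp add: is_cantor_expansion_def digit_scale_def y_def frac_def E_def)
  then show ?thesis by blast
qed

lemma cantor_digits_eqI:
  assumes "basic_sequence Q" "is_cantor_expansion Q x E"
  shows "cantor_digits Q x = E"
  unfolding cantor_digits_def using assms by (blast intro: the_equality cantor_expansion_unique)

lemma cantor_digits_expansion:
  assumes "basic_sequence Q"
  shows "is_cantor_expansion Q x (cantor_digits Q x)"
  using cantor_expansion_exists[OF assms, of x] cantor_digits_eqI[OF assms] by metis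

text \<open>After a zero digit the prefix is exactly \<open>Q (Suc n)\<close> times the previous
  one, which bounds \<open>digit_scale Q n * frac x\<close>. Passing from \<open>frac x\<close> to
  \<open>x\<close> adds an integer.\<close>

lemma cantor_digit_zero:
  assumes Q: "basic_sequence Q" and z: "cantor_digits Q x (Suc n) = 0"
  shows "\<exists>k::int. of_int k \<le> digit_scale Q n * x \<and> digit_scale Q n * x < of_int k + 1 / real (Q (Suc n))"
proof -
  define I where "I = digit_prefix Q (cantor_digits Q x)"
  have I: "int (I m) = \<lfloor>digit_scale Q m * frac x\<rfloor>" for m
    unfolding I_def by (rule cantor_expansion_prefix[OF Q cantor_digits_expansion[OF Q]])
  have q: "real (Q (Suc n)) > 0" using basic_sequence_Suc[OF Q, of n] by simp
  have IS: "I (Suc n) = I n * Q (Suc n)" by (simp add: I_def z)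
  have l: "real (I n) \<le> digit_scale Q n * frac x" using I[of n] by linarith
  have "digit_scale Q (Suc n) * frac x < real (I (Suc n)) + 1" using I[of "Suc n"] by linarith
  then have u: "digit_scale Q n * frac x < real (I n) + 1 / real (Q (Suc n))"
    using q by (simp add: IS digit_scale_Suc field_simps)
  define p where "p = int (\<Prod>j=1..n. Q j)"
  have p: "digit_scale Q n = of_int p" by (simp add: digit_scale_def p_def)
  have "digit_scale Q n * x = digit_scale Q n * frac x + of_int (p * \<lfloor>x\<rfloor>)"
    by (simp add: frac_def p algebra_simps)
  then show ?thesis using l u by (intro exI[of _ "int (I n) + p * \<lfloor>x\<rfloor>"]) auto
qed

text \<open>The cap \<open>Q n - 2\<close> excludes a tail of maximal digits, so every such sequence
  is already an admissible expansion.\<close>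

lemma ex_cantor_digits_eq:
  assumes Q: "basic_sequence Q" and E0: "E 0 = 0" and E: "\<And>n. n \<ge> 1 \<Longrightarrow> E n \<le> Q n - 2"
  shows "\<exists>x. cantor_digits Q x = E"
proof -
  have lt: "E n \<in> {0..Q n - 1}" "E n \<noteq> Q n - 1" if "n \<ge> 1" for n
    using E[OF that] that Q by (auto simp: basic_sequence_def)
  have "{n. n \<ge> 1 \<and> E n \<noteq> Q n - 1} = {1..}" using lt(2) by auto
  then have inf: "infinite {n. n \<ge> 1 \<and> E n \<noteq> Q n - 1}" by (simp add: infinite_Ici)
  define t where "t n = real (E (Suc n)) / digit_scale Q (Suc n)" for n
  have "summable t"
  \<comment> \<open>This telescoping majorant is the series with all digits maximal.\<close>
  proof (rule summable_comparison_test'[of "\<lambda>n. 1 / digit_scale Q n - 1 / digit_scale Q (Suc n)" 0])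
    show "summable (\<lambda>n. 1 / digit_scale Q n - 1 / digit_scale Q (Suc n))"
      using telescope_sums'[OF inverse_digit_scale_tendsto_0[OF Q]] by (rule sums_summable)
    fix n
    have "real (E (Suc n)) \<le> real (Q (Suc n)) - 1"
      using lt(1)[of "Suc n"] basic_sequence_Suc[OF Q, of n] by simp
    then have "t n \<le> (real (Q (Suc n)) - 1) / digit_scale Q (Suc n)"
      unfolding t_def by (intro divide_right_mono) (auto simp: less_imp_le digit_scale_pos[OF Q])
    also have "\<dots> = 1 / digit_scale Q n - 1 / digit_scale Q (Suc n)"
      using digit_scale_pos[OF Q, of n] basic_sequence_Suc[OF Q, of n]
      by (simp add: digit_scale_Suc field_simps)
    finally show "norm (t n) \<le> 1 / digit_scale Q n - 1 / digit_scale Q (Suc n)"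
      using digit_scale_pos[OF Q, of "Suc n"] by (simp add: t_def)
  qed
  then have sums: "t sums suminf t" by (rule summable_sums)
  have "0 \<le> suminf t" "suminf t < 1"
    using digit_series_bounds[OF Q lt(1) inf, of "suminf t" 0] sums unfolding t_def by auto
  then have "\<lfloor>suminf t\<rfloor> = 0" by (simp add: floor_eq_iff)
  then have "is_cantor_expansion Q (suminf t) E"
    using E0 lt(1) inf sums by (simp add: is_cantor_expansion_def t_def[abs_def] digit_scale_def)
  then show ?thesis using cantor_digits_eqI[OF Q] by blast
qed


section \<open>Numbers with prescribed digit frequencies\<close>

text \<open>For monotone \<open>f\<close> this is the position of \<open>n\<close>, counted from 0,
  in its run of equal values. The witnesses below take their digit pattern from it.\<close>

definition level_offset :: "(nat \<Rightarrow> nat) \<Rightarrow> nat \<Rightarrow> nat" where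
  "level_offset f n = n - (LEAST m. f m = f n)"

lemma level_offset_Suc:
  assumes "mono f"
  shows "level_offset f (Suc n) = (if f (Suc n) = f n then Suc (level_offset f n) else 0)"
proof (cases "f (Suc n) = f n")
  case True
  have "(LEAST m. f m = f n) \<le> n" by (rule Least_le) simp
  with True show ?thesis by (simp add: level_offset_def Suc_diff_le)
next
  case False
  have "(LEAST m. f m = f (Suc n)) = Suc n"
  proof (rule Least_equality)
    fix m assume m: "f m = f (Suc n)"
    show "Suc n \<le> m"
    proof (rule ccontr)
      assume "\<not> Suc n \<le> m"
      then have "f m \<le> f n" "f n \<le> f (Suc n)" using assms by (auto intro: monoD)
      with m False show False by simp
    qed
  qed simp
  with False show ?thesis by (simp add: level_offset_def)
qed

text \<open>Offset \<open>j\<close> at \<open>Suc (n + j)\<close> means that the run starts at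
  \<open>Suc n\<close>, so \<open>f\<close> jumps there. Conversely, after that jump
  \<open>slow\<close> leaves no room for a second one up to \<open>Suc (n + j)\<close>.\<close>

lemma level_offset_eq_iff:
  assumes f: "mono f" and slow: "f (n + Suc j) \<le> Suc (f n)"
  shows "level_offset f (Suc (n + j)) = j \<longleftrightarrow> f (Suc n) \<noteq> f n"
  using slow
proof (induction j)
  case 0
  then show ?case by (simp add: level_offset_Suc[OF f])
next
  case (Suc j)
  have le: "f n \<le> f (Suc n)" "f (Suc n) \<le> f (Suc (n + j))" "f (Suc (n + j)) \<le> f (Suc (Suc (n + j)))"
    using f by (auto intro: monoD)
  then show ?case using Suc by (auto simp: level_offset_Suc[OF f, of "Suc (n + j)"])
qed

text \<open>For late \<open>i\<close>, offset \<open>j\<close> at \<open>i\<close> and offset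
  \<open>Suc j\<close> at \<open>Suc i\<close> both say that \<open>f\<close> jumps right after
  \<open>i - Suc j\<close>.\<close>

lemma eventually_level_offset_Suc:
  assumes f: "mono f" and slow: "\<And>j. \<forall>\<^sub>F n in sequentially. f (n + j) \<le> Suc (f n)"
  shows "\<forall>\<^sub>F i in sequentially. level_offset f i = j \<longrightarrow> level_offset f (Suc i) = Suc j"
proof -
  obtain N where N: "\<And>n. n \<ge> N \<Longrightarrow> f (n + Suc (Suc j)) \<le> Suc (f n)"
    using slow[of "Suc (Suc j)"] unfolding eventually_sequentially by blast
  have "level_offset f i = j \<longrightarrow> level_offset f (Suc i) = Suc j" if i: "i \<ge> Suc (N + j)" for i
  proof -
    define n where "n = i - Suc j"
    have n: "i = Suc (n + j)" "n \<ge> N" using i by (auto simp: n_def)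
    have "f (n + Suc j) \<le> f (n + Suc (Suc j))" using f by (auto intro: monoD)
    with N[OF n(2)] have "f (n + Suc j) \<le> Suc (f n)" by linarith
    from level_offset_eq_iff[OF f this] level_offset_eq_iff[OF f N[OF n(2)]] n
    show ?thesis by simp
  qed
  then show ?thesis by (auto intro: eventually_sequentiallyI)
qed

text \<open>Eventually every jump of \<open>f\<close> has size 1 and yields exactly one index with
  offset \<open>j\<close>, namely \<open>j\<close> places later. So the count up to
  \<open>n + j\<close> and \<open>f n\<close> grow in step.\<close>

lemma card_level_offset_eventually_close:
  assumes f: "mono f" and slow: "\<And>j. \<forall>\<^sub>F n in sequentially. f (n + j) \<le> Suc (f n)"
    and A: "\<forall>\<^sub>F i in sequentially. A i \<longleftrightarrow> level_offset f i = j"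
  shows "\<exists>C. \<forall>\<^sub>F n in sequentially. \<bar>real (card {i \<in> {1..n}. A i}) - real (f n)\<bar> \<le> C"
proof -
  obtain N where N: "\<And>n. n \<ge> N \<Longrightarrow> f (n + Suc j) \<le> Suc (f n)"
      "\<And>i. i \<ge> N \<Longrightarrow> A i \<longleftrightarrow> level_offset f i = j"
    using eventually_conj[OF slow[of "Suc j"] A] unfolding eventually_sequentially by blast
  define c where "c n = card {i \<in> {1..n}. A i}" for n
  have le: "f n \<le> f (Suc n)" "f (Suc n) \<le> f (n + Suc j)" "f n \<le> f (n + j)" "f (n + j) \<le> f (n + Suc j)" for n
    using f by (auto intro: monoD)
  have count_Suc: "c (Suc n + j) + f n = c (n + j) + f (Suc n)" if n: "n \<ge> N" for n
  proof -
    have "{i \<in> {1..Suc (n + j)}. A i} = (if A (Suc (n + j)) then insert (Suc (n + j)) else id) {i \<in> {1..n + j}. A i}"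
      by (auto simp: le_Suc_eq)
    then have "c (Suc n + j) = (if A (Suc (n + j)) then Suc (c (n + j)) else c (n + j))"
      by (auto simp: c_def)
    moreover have "A (Suc (n + j)) \<longleftrightarrow> f (Suc n) \<noteq> f n"
      using N(2)[of "Suc (n + j)"] level_offset_eq_iff[OF f N(1)[OF n]] n by simp
    ultimately show ?thesis using N(1)[OF n] le[of n] by (auto split: if_splits)
  qed
  have count: "c (n + j) + f N = c (N + j) + f n" if "n \<ge> N" for n
    using that
  proof (induction n rule: dec_induct)
    case (step n)
    then show ?case using count_Suc[of n] by linarith
  qed simp
  \<comment> \<open>The summand 1 bounds the change of \<open>f\<close> between \<open>n\<close> and
    \<open>m = n + j\<close>.\<close>
  have "\<bar>real (c m) - real (f m)\<bar> \<le> real (c (N + j)) + real (f N) + 1" if m: "m \<ge> N + j" for m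
  proof -
    define n where "n = m - j"
    have n: "m = n + j" "n \<ge> N" using m by (auto simp: n_def)
    show ?thesis unfolding n(1) using count[OF n(2)] N(1)[OF n(2)] le[of n] by linarith
  qed
  then show ?thesis unfolding c_def by (auto intro!: exI eventually_sequentiallyI)
qed

text \<open>Increments over a fixed number of steps tend to 0, so they are eventually below 1 and
  the floor rises by at most 1.\<close>

lemma nat_floor_slow:
  fixes F :: "nat \<Rightarrow> real"
  assumes F: "mono F" "F 0 \<ge> 0" and inc: "(\<lambda>n. F (Suc n) - F n) \<longlonglongrightarrow> 0"
  shows "mono (\<lambda>n. nat \<lfloor>F n\<rfloor>)"
    and "\<forall>\<^sub>F n in sequentially. nat \<lfloor>F (n + j)\<rfloor> \<le> Suc (nat \<lfloor>F n\<rfloor>)"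
proof -
  show "mono (\<lambda>n. nat \<lfloor>F n\<rfloor>)"
    using F(1) by (auto simp: mono_def intro!: nat_mono floor_mono)
  have nonneg: "F n \<ge> 0" for n using F(2) monoD[OF F(1), of 0 n] by simp
  have "(\<lambda>n. F (n + j) - F n) \<longlonglongrightarrow> 0"
  proof (induction j)
    case (Suc j)
    have "(\<lambda>n. (F (Suc (n + j)) - F (n + j)) + (F (n + j) - F n)) \<longlonglongrightarrow> 0 + 0"
      using LIMSEQ_ignore_initial_segment[OF inc, of j] by (intro tendsto_add Suc) simp
    then show ?case by simp
  qed simp
  then have "\<forall>\<^sub>F n in sequentially. F (n + j) - F n < 1" by (rule order_tendstoD) simp
  then show "\<forall>\<^sub>F n in sequentially. nat \<lfloor>F (n + j)\<rfloor> \<le> Suc (nat \<lfloor>F n\<rfloor>)"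
  proof eventually_elim
    case (elim n)
    then have "\<lfloor>F (n + j)\<rfloor> \<le> \<lfloor>F n\<rfloor> + 1" by linarith
    then show ?case using nonneg[of n] by linarith
  qed
qed

lemma level_offset_frequency:
  fixes F :: "nat \<Rightarrow> real"
  assumes F: "mono F" "F 0 \<ge> 0" and inc: "(\<lambda>n. F (Suc n) - F n) \<longlonglongrightarrow> 0"
    and lim: "filterlim F at_top sequentially"
    and A: "\<forall>\<^sub>F i in sequentially. A i \<longleftrightarrow> level_offset (\<lambda>n. nat \<lfloor>F n\<rfloor>) i = j"
  shows "(\<lambda>n. real (card {i \<in> {1..n}. A i}) / F n) \<longlonglongrightarrow> 1"
proof -
  obtain C where C: "\<forall>\<^sub>F n in sequentially.
      \<bar>real (card {i \<in> {1..n}. A i}) - real (nat \<lfloor>F n\<rfloor>)\<bar> \<le> C"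
    using card_level_offset_eventually_close[OF nat_floor_slow(1)[OF F inc] nat_floor_slow(2)[OF F inc] A]
    by blast
  have "((\<lambda>n. real (card {i \<in> {1..n}. A i}) / F n - 1) \<longlongrightarrow> 0) sequentially"
  proof (rule Lim_null_comparison)
    \<comment> \<open>The extra 1 pays for rounding \<open>F n\<close> down.\<close>
    show "(\<lambda>n. (C + 1) / F n) \<longlonglongrightarrow> 0"
      by (rule tendsto_divide_0[OF tendsto_const filterlim_at_top_imp_at_infinity[OF lim]])
    have "\<forall>\<^sub>F n in sequentially. F n > 0" using lim by (simp add: filterlim_at_top_dense)
    with C show "\<forall>\<^sub>F n in sequentially. norm (real (card {i \<in> {1..n}. A i}) / F n - 1) \<le> (C + 1) / F n"
    proof eventually_elim
      case (elim n)
      have "\<bar>real (card {i \<in> {1..n}. A i}) - F n\<bar> \<le> C + 1" using elim by linarith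
      then have "\<bar>real (card {i \<in> {1..n}. A i}) - F n\<bar> / F n \<le> (C + 1) / F n"
        using elim by (intro divide_right_mono) auto
      moreover have "real (card {i \<in> {1..n}. A i}) / F n - 1 = (real (card {i \<in> {1..n}. A i}) - F n) / F n"
        using elim by (simp add: field_simps)
      ultimately show ?case using elim by simp
    qed
  qed
  then show ?thesis by (simp add: LIM_zero_iff)
qed

section \<open>Explicit members of the two normality sets\<close>

lemma infinite_in_limit_eventually_ge:
  "infinite_in_limit Q \<Longrightarrow> \<forall>\<^sub>F n in sequentially. Q n \<ge> c"
  by (simp add: infinite_in_limit_def filterlim_at_top)

lemma infinite_in_limit_inverse_tendsto_0:
  assumes "infinite_in_limit Q"
  shows "(\<lambda>n. 1 / real (Q n)) \<longlonglongrightarrow> 0"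
proof -
  have "filterlim (\<lambda>n. real (Q n)) at_top sequentially"
    using assms unfolding infinite_in_limit_def by (rule filterlim_compose[OF filterlim_real_sequentially])
  then show ?thesis
    by (intro tendsto_divide_0[OF tendsto_const] filterlim_at_top_imp_at_infinity)
qed

text \<open>The digits run through 0, 1, 2, ... anew at each jump of the floor of
  \<open>Qsum1 Q\<close>. Late runs are long, so a fixed digit occurs about once per run, that is,
  about \<open>Qsum1 Q n\<close> times.\<close>

lemma N1_nonempty:
  assumes Q: "basic_sequence Q" and lim: "infinite_in_limit Q" and div: "one_divergent Q"
  shows "N1 Q \<noteq> {}"
proof -
  define F where "F = Qsum1 Q"
  define f where "f n = nat \<lfloor>F n\<rfloor>" for n
  define E where "E n = (if n = 0 then 0 else min (level_offset f n) (Q n - 2))" for n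
  have F_Suc: "F (Suc n) = F n + 1 / real (Q (Suc n))" for n by (simp add: F_def Qsum1_def)
  have "mono F" by (rule mono_iff_le_Suc[THEN iffD2]) (simp add: F_Suc)
  moreover have "F 0 \<ge> 0" by (simp add: F_def Qsum1_def)
  moreover have "(\<lambda>n. F (Suc n) - F n) \<longlonglongrightarrow> 0"
  proof -
    have "(\<lambda>n. 1 / real (Q (Suc n))) \<longlonglongrightarrow> 0"
      by (rule LIMSEQ_Suc[OF infinite_in_limit_inverse_tendsto_0[OF lim]])
    then show ?thesis by (simp add: F_Suc)
  qed
  moreover have "filterlim F at_top sequentially" using div by (simp add: one_divergent_def F_def)
  \<comment> \<open>\<open>Q i >= b + 3\<close> gives \<open>Q i - 2 > b\<close>, so the cap neither
    removes nor creates a digit \<open>b\<close>.\<close>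
  moreover have "\<forall>\<^sub>F i in sequentially. E i = b \<longleftrightarrow> level_offset f i = b" for b
    using infinite_in_limit_eventually_ge[OF lim, of "b + 3"] eventually_gt_at_top[of 0]
    by eventually_elim (auto simp: E_def)
  ultimately have freq: "(\<lambda>n. real (card {i \<in> {1..n}. E i = b}) / F n) \<longlonglongrightarrow> 1" for b
    unfolding f_def by (rule level_offset_frequency)
  obtain x where x: "cantor_digits Q x = E"
    using ex_cantor_digits_eq[OF Q, of E] by (auto simp: E_def)
  have "x \<in> N1 Q"
    using freq by (auto simp: N1_def block_count_def x length_Suc_conv F_def)
  then show ?thesis by blast
qed

lemma RN2_nonempty:
  assumes Q: "basic_sequence Q" and lim: "infinite_in_limit Q"
  shows "RN2 Q \<noteq> {}"
proof -
  \<comment> \<open>Only quotients of counts matter, so any unbounded increasing function with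
    vanishing steps can serve.\<close>
  define F where "F = (harm :: nat \<Rightarrow> real)"
  define f where "f n = nat \<lfloor>F n\<rfloor>" for n
  define w where "w n = level_offset f n" for n
  \<comment> \<open>The pattern lists all pairs, separated by the large digit \<open>Q n - 2\<close> so that no further
    occurrences of a fixed pair arise at the seams.\<close>
  define E where "E n = (if n = 0 then 0
      else if w n mod 3 = 1 then min (fst (prod_decode (w n div 3))) (Q n - 2)
      else if w n mod 3 = 2 then min (snd (prod_decode (w n div 3))) (Q n - 2)
      else Q n - 2)" for n
  have F: "mono F" "F 0 \<ge> 0" "(\<lambda>n. F (Suc n) - F n) \<longlonglongrightarrow> 0" "filterlim F at_top sequentially"
  proof -
    show "mono F" by (simp add: F_def mono_def harm_mono)
    show "F 0 \<ge> 0" by (simp add: F_def harm_nonneg)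
    show "(\<lambda>n. F (Suc n) - F n) \<longlonglongrightarrow> 0"
      using LIMSEQ_inverse_real_of_nat by (simp add: F_def harm_Suc)
    show "filterlim F at_top sequentially" unfolding F_def by (rule harm_at_top)
  qed
  have f: "mono f" "\<And>j. \<forall>\<^sub>F n in sequentially. f (n + j) \<le> Suc (f n)"
    unfolding f_def by (rule nat_floor_slow[OF F(1-3)])+
  have block: "\<forall>\<^sub>F i in sequentially. E i = a \<and> E (Suc i) = b \<longleftrightarrow>
      level_offset f i = 3 * prod_encode (a, b) + 1" for a b
  proof -
    have q: "\<forall>\<^sub>F n in sequentially. Q n \<ge> a + b + 3"
      by (rule infinite_in_limit_eventually_ge[OF lim])
    have q': "\<forall>\<^sub>F n in sequentially. Q (Suc n) \<ge> a + b + 3"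
      using q by (rule eventually_sequentially_Suc[THEN iffD2])
    show ?thesis
      using q q' eventually_gt_at_top[of 0]
        eventually_level_offset_Suc[OF f, of "3 * prod_encode (a, b) + 1"]
    proof eventually_elim
      case (elim i)
      let ?k = "prod_encode (a, b)"
      show ?case
      proof
        assume "E i = a \<and> E (Suc i) = b"
        then have a: "E i = a" and b: "E (Suc i) = b" by auto
        \<comment> \<open>Neither digit is a separator, so both offsets are nonzero mod 3. In
          particular the offset of \<open>Suc i\<close> is not 0, so both indices lie in one run and
          the residues are 1 and 2.\<close>
        have Qs: "a < Q i - 2" "b < Q i - 2" "a < Q (Suc i) - 2" "b < Q (Suc i) - 2"
          using elim by auto
        have m: "w i mod 3 \<noteq> 0" "w (Suc i) mod 3 \<noteq> 0"
          using a b Qs elim by (auto simp: E_def split: if_splits)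
        then have "w (Suc i) \<noteq> 0" by auto
        then have ws: "w (Suc i) = Suc (w i)"
          using level_offset_Suc[OF f(1), of i] by (auto simp: w_def split: if_splits)
        have mod: "w i mod 3 = 1" "w (Suc i) mod 3 = 2" "w (Suc i) div 3 = w i div 3"
          using m unfolding ws by presburger+
        have "fst (prod_decode (w i div 3)) = a" "snd (prod_decode (w i div 3)) = b"
          using a b mod Qs elim(3) by (auto simp: E_def min_def split: if_splits)
        then have "prod_decode (w i div 3) = (a, b)" by (simp add: prod_eq_iff)
        then have "w i div 3 = ?k" by (metis prod_decode_inverse)
        then show "level_offset f i = 3 * ?k + 1"
          using mod(1) div_mult_mod_eq[of "w i" 3] by (simp add: w_def)
      next
        \<comment> \<open>Here \<open>elim(4)\<close> ensures that the run does not end between the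
          two entries of the pair.\<close>
        assume wi: "level_offset f i = 3 * ?k + 1"
        have "w i mod 3 = 1" "w i div 3 = ?k" "w (Suc i) mod 3 = 2" "w (Suc i) div 3 = ?k"
          using wi elim(4) unfolding w_def by presburger+
        then show "E i = a \<and> E (Suc i) = b" using elim by (simp add: E_def)
      qed
    qed
  qed
  have freq: "(\<lambda>n. real (card {i \<in> {1..n}. E i = a \<and> E (Suc i) = b}) / F n) \<longlonglongrightarrow> 1" for a b
    using level_offset_frequency[OF F block[unfolded f_def]] .
  have "E n \<le> Q n - 2" if "n \<ge> 1" for n using that by (auto simp: E_def)
  then obtain x where x: "cantor_digits Q x = E"
    using ex_cantor_digits_eq[OF Q, of E] by (auto simp: E_def)
  have count: "(\<lambda>n. real (block_count Q n B x) / F n) \<longlonglongrightarrow> 1" if B: "length B = 2" for B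
  proof -
    obtain a b where B: "B = [a, b]" using B by (auto simp: length_Suc_conv numeral_2_eq_2)
    show ?thesis using freq[of a b] by (simp add: block_count_def x B less_Suc_eq numeral_2_eq_2 all_conj_distrib imp_conjL)
  qed
  have Fpos: "\<forall>\<^sub>F n in sequentially. F n > 0" using F(4) by (simp add: filterlim_at_top_dense)
  have "(\<lambda>n. real (block_count Q n B\<^sub>1 x) / real (block_count Q n B\<^sub>2 x)) \<longlonglongrightarrow> 1"
    if "length B\<^sub>1 = 2" "length B\<^sub>2 = 2" for B\<^sub>1 B\<^sub>2
  proof -
    have "(\<lambda>n. (real (block_count Q n B\<^sub>1 x) / F n) / (real (block_count Q n B\<^sub>2 x) / F n)) \<longlonglongrightarrow> 1 / 1"
      by (intro tendsto_divide count that) simp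
    moreover have "\<forall>\<^sub>F n in sequentially. (real (block_count Q n B\<^sub>1 x) / F n) / (real (block_count Q n B\<^sub>2 x) / F n)
        = real (block_count Q n B\<^sub>1 x) / real (block_count Q n B\<^sub>2 x)"
      using Fpos by eventually_elim simp
    ultimately show ?thesis by (simp add: Lim_transform_eventually)
  qed
  then have "x \<in> RN2 Q" by (simp add: RN2_def)
  then show ?thesis by blast
qed

section \<open>Numbers with finitely many zero digits\<close>

lemma finitely_many_zero_digits_block_bound:
  assumes "\<And>n. n \<ge> N \<Longrightarrow> cantor_digits Q x n \<noteq> 0"
  shows "block_count Q n (0 # B) x \<le> N"
proof -
  have "{i \<in> {1..n}. \<forall>j<length (0 # B). cantor_digits Q x (i + j) = (0 # B) ! j} \<subseteq> {..<N}"
  proof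
    fix i assume "i \<in> {i \<in> {1..n}. \<forall>j<length (0 # B). cantor_digits Q x (i + j) = (0 # B) ! j}"
    then have "cantor_digits Q x (i + 0) = (0 # B) ! 0" by blast
    then show "i \<in> {..<N}" using assms[of i] by (cases "i < N") auto
  qed
  from card_mono[OF _ this] show ?thesis by (simp add: block_count_def)
qed

lemma finitely_many_zero_digits_notin_N1:
  assumes div: "one_divergent Q" and N: "\<And>n. n \<ge> N \<Longrightarrow> cantor_digits Q x n \<noteq> 0"
  shows "x \<notin> N1 Q"
proof
  assume "x \<in> N1 Q"
  then have one: "(\<lambda>n. real (block_count Q n [0] x) / Qsum1 Q n) \<longlonglongrightarrow> 1" by (simp add: N1_def)
  have "(\<lambda>n. real (block_count Q n [0] x) / Qsum1 Q n) \<longlonglongrightarrow> 0"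
  proof (rule Lim_null_comparison)
    show "(\<lambda>n. real N / Qsum1 Q n) \<longlonglongrightarrow> 0"
      using div unfolding one_divergent_def
      by (intro tendsto_divide_0[OF tendsto_const] filterlim_at_top_imp_at_infinity)
    have "Qsum1 Q n \<ge> 0" for n by (simp add: Qsum1_def sum_nonneg)
    then show "\<forall>\<^sub>F n in sequentially. norm (real (block_count Q n [0] x) / Qsum1 Q n) \<le> real N / Qsum1 Q n"
      using finitely_many_zero_digits_block_bound[OF N, where B = "[]"]
      by (auto intro!: always_eventually divide_right_mono)
  qed
  with one show False using LIMSEQ_unique by fastforce
qed

text \<open>It is not enough that one block occurs finitely often: every block of length 2 may occur
  exactly once, and then all quotients tend to 1. But finitely many zeros cannot start the
  infinitely many blocks \<open>[0, b]\<close>.\<close>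

lemma finitely_many_zero_digits_notin_RN2:
  assumes N: "\<And>n. n \<ge> N \<Longrightarrow> cantor_digits Q x n \<noteq> 0"
  shows "x \<notin> RN2 Q"
proof
  assume x: "x \<in> RN2 Q"
  have "\<exists>i<N. cantor_digits Q x (Suc i) = b" for b
  proof (rule ccontr)
    assume b: "\<not> (\<exists>i<N. cantor_digits Q x (Suc i) = b)"
    have "{i \<in> {1..n}. \<forall>j<length [0, b]. cantor_digits Q x (i + j) = [0, b] ! j} = {}" for n
    proof (rule equals0I)
      fix i assume "i \<in> {i \<in> {1..n}. \<forall>j<length [0, b]. cantor_digits Q x (i + j) = [0, b] ! j}"
      then have *: "cantor_digits Q x (i + j) = [0, b] ! j" if "j < 2" for j using that by auto
      from *[of 0] *[of 1] have "cantor_digits Q x i = 0" "cantor_digits Q x (Suc i) = b" by auto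
      moreover from this have "i < N" using N[of i] by (cases "i < N") auto
      ultimately show False using b by blast
    qed
    then have "block_count Q n [0, b] x = 0" for n by (simp only: block_count_def card.empty)
    \<comment> \<open>The block is compared with itself: if it never occurs, every quotient is 0 / 0
      = 0.\<close>
    moreover have "(\<lambda>n. real (block_count Q n [0, b] x) / real (block_count Q n [0, b] x)) \<longlonglongrightarrow> 1"
      using x[unfolded RN2_def, THEN CollectD, rule_format, of "[0, b]" "[0, b]"] by (simp only: list.size) simp
    ultimately show False by (simp add: LIMSEQ_const_iff)
  qed
  \<comment> \<open>Every natural number would be one of the digits at positions 1 to
    \<open>N\<close>.\<close>
  then have "(UNIV :: nat set) \<subseteq> (\<lambda>i. cantor_digits Q x (Suc i)) ` {..<N}" by (auto simp: image_iff eq_commute)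
  then show False using finite_subset[OF _ finite_imageI[OF finite_lessThan]] infinite_UNIV_nat by blast
qed

section \<open>Schmidt's game\<close>

lemma radius_closed_interval: "a \<le> b \<Longrightarrow> radius {a..b} = (b - a) / 2"
  by (simp add: radius_def)

lemma bob_legal_upto_closed_interval:
  "bob_legal_upto \<beta> \<sigma> B n \<Longrightarrow> closed_interval (B n)"
  by (cases n) (auto simp: bob_legal_upto_def legal_move_def)

lemma winning2_mono: "winning2 \<alpha> \<beta> S \<Longrightarrow> S \<subseteq> T \<Longrightarrow> winning2 \<alpha> \<beta> T"
  unfolding winning2_def by (meson order_trans)

text \<open>If \<open>\<alpha> > 1/2\<close> and \<open>\<beta>\<close> is small, every reply of Alice to an interval centred at \<open>x\<close> contains
  the smaller interval centred at \<open>x\<close>, so Bob can keep \<open>x\<close> as his centre.\<close>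

lemma not_winning_above_half:
  assumes \<alpha>: "1/2 < \<alpha>" "\<alpha> < 1" and x: "x \<notin> S"
  shows "\<not> winning \<alpha> S"
proof
  assume win: "winning \<alpha> S"
  \<comment> \<open>An interval of radius \<open>\<alpha> * r\<close> inside the one of radius
    \<open>r\<close> centred at \<open>x\<close> reaches at least
    \<open>(2 * \<alpha> - 1) * r\<close> to both sides of \<open>x\<close>. This \<beta> gives
    Bob's next interval exactly that radius.\<close>
  define \<beta> where "\<beta> = (2 * \<alpha> - 1) / \<alpha>"
  have \<beta>: "0 < \<beta>" "\<beta> < 1" "\<alpha> * \<beta> = 2 * \<alpha> - 1" using \<alpha> by (auto simp: \<beta>_def field_simps)
  obtain \<sigma> where legal: "\<And>B n. bob_legal_upto \<beta> \<sigma> B n \<Longrightarrow> legal_move \<alpha> (B n) (alice_move \<sigma> B n)"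
    and wins: "\<And>B. (\<And>n. bob_legal_upto \<beta> \<sigma> B n) \<Longrightarrow> (\<Inter>n. B n) \<subseteq> S"
    using win \<beta>(1,2) unfolding winning_def winning2_def by metis
  define r where "r n = (\<alpha> * \<beta>) ^ n" for n
  define B where "B n = {x - r n..x + r n}" for n
  have r: "r n > 0" "r (Suc n) = (2 * \<alpha> - 1) * r n" for n using \<alpha> \<beta> by (auto simp: r_def)
  have radB: "radius (B n) = r n" for n using r(1)[of n] by (simp add: B_def radius_closed_interval)
  have cB: "closed_interval (B n)" for n
    using r(1)[of n] unfolding closed_interval_def B_def by (intro exI[of _ "x - r n"] exI[of _ "x + r n"]) simp
  have "bob_legal_upto \<beta> \<sigma> B n" for n
  proof (induction n)
    case 0
    then show ?case using cB by (simp add: bob_legal_upto_def)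
  next
    case (Suc n)
    from legal[OF Suc] obtain a b where ab: "a < b" "alice_move \<sigma> B n = {a..b}" "{a..b} \<subseteq> B n"
      "radius {a..b} = \<alpha> * r n"
      by (auto simp: legal_move_def closed_interval_def radB)
    have len: "b - a = 2 * \<alpha> * r n" using ab by (simp add: radius_closed_interval)
    have "x - r n \<le> a" "b \<le> x + r n" using ab by (auto simp: B_def)
    then have "B (Suc n) \<subseteq> {a..b}" using len by (auto simp: B_def r(2) algebra_simps)
    moreover have "radius (B (Suc n)) = \<beta> * radius {a..b}"
      unfolding ab(4) radB r(2) \<beta>(3)[symmetric] by (simp add: mult_ac)
    ultimately have "legal_move \<beta> (alice_move \<sigma> B n) (B (Suc n))"
      using cB by (simp add: legal_move_def ab(2))
    with Suc show ?case by (auto simp: bob_legal_upto_def less_Suc_eq)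
  qed
  then have "(\<Inter>n. B n) \<subseteq> S" by (rule wins)
  moreover have "x \<in> (\<Inter>n. B n)" using r(1) by (auto simp: B_def less_imp_le)
  ultimately show False using x by blast
qed

text \<open>The zero-digit sets at position \<open>Suc n\<close> are short intervals at mutual distance about
  \<open>1 / digit_scale Q n\<close>. Hence at most one of them meets an interval of half that length, and it
  cannot meet both the leftmost and the rightmost reply of Alice.\<close>

lemma zero_digit_avoiding_reply:
  assumes Q: "basic_sequence Q" and \<alpha>: "0 < \<alpha>" "\<alpha> < 1/2" and c: "0 < c" "c < 1"
    and ab: "a < b"
    and q: "1 / real (Q (Suc n)) < (1 - 2 * \<alpha>) * c / 2"
    and len: "c * (1 / digit_scale Q n / 2) < b - a" "b - a \<le> 1 / digit_scale Q n / 2"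
  shows "\<exists>A. legal_move \<alpha> {a..b} A \<and> (\<forall>x\<in>A. cantor_digits Q x (Suc n) \<noteq> 0)"
proof (rule ccontr)
  assume no: "\<not> ?thesis"
  define l where "l = \<alpha> * (b - a)"
  have l: "0 < l" "2 * l < b - a" using \<alpha> ab mult_strict_right_mono[of \<alpha> "1/2" "b - a"] by (auto simp: l_def)
  have left: "legal_move \<alpha> {a..b} {a..a + l}" and right: "legal_move \<alpha> {a..b} {b - l..b}"
    unfolding legal_move_def closed_interval_def using l ab
    by (auto simp: radius_closed_interval simp flip: l_def)
  obtain x y where x: "a \<le> x" "x \<le> a + l" "cantor_digits Q x (Suc n) = 0"
    and y: "b - l \<le> y" "y \<le> b" "cantor_digits Q y (Suc n) = 0"
    using no left right by (meson atLeastAtMost_iff)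
  define P where "P = digit_scale Q n"
  define e where "e = 1 / real (Q (Suc n))"
  have P: "P > 0" by (simp add: P_def digit_scale_pos[OF Q])
  have e: "e \<le> 1/2" using basic_sequence_Suc[OF Q, of n] by (simp add: e_def field_simps)
  obtain i j :: int where i: "of_int i \<le> P * x" "P * x < of_int i + e" and j: "of_int j \<le> P * y" "P * y < of_int j + e"
    using cantor_digit_zero[OF Q x(3)] cantor_digit_zero[OF Q y(3)] unfolding P_def e_def by blast
  have xy: "(1 - 2 * \<alpha>) * (b - a) \<le> y - x" "y - x \<le> b - a" "x < y"
    using x y l by (auto simp: l_def algebra_simps)
  \<comment> \<open>After scaling by \<open>P\<close> the interval has length at most 1/2, and
    \<open>e\<close> is at most 1/2, so both zeros sit just above the same integer.\<close>
  have "P * (b - a) \<le> 1/2" using len(2) P by (simp add: P_def[symmetric] field_simps)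
  moreover have "P * (y - x) \<le> P * (b - a)" using xy P by simp
  ultimately have "P * y - P * x \<le> 1/2" by (simp add: algebra_simps)
  moreover have "P * x < P * y" using xy P by simp
  ultimately have "real_of_int i < of_int j + 1" "real_of_int j < of_int i + 1"
    using i j e by linarith+
  then have "i = j" by linarith
  then have "P * (y - x) < e" using i j by (simp add: algebra_simps)
  \<comment> \<open>The gap between the two replies, scaled by \<open>P\<close>, exceeds
    \<open>(1 - 2 * \<alpha>) * c / 2\<close> and hence \<open>e\<close>, a contradiction.\<close>
  moreover have "P * (b - a) > c / 2" using len(1) P by (simp add: P_def[symmetric] field_simps)
  then have "(1 - 2 * \<alpha>) * (P * (b - a)) > (1 - 2 * \<alpha>) * (c / 2)"
    using \<alpha> by (intro mult_strict_left_mono) auto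
  moreover have "P * ((1 - 2 * \<alpha>) * (b - a)) \<le> P * (y - x)" using xy(1) P by simp
  ultimately show False using q by (simp add: e_def algebra_simps)
qed

text \<open>Alice deals with position \<open>Suc n\<close> when the diameter of Bob's interval lies
  in the window \<open>(c * h n, h n]\<close>. A round shrinks diameters by the factor
  \<open>c\<close>, so no window below the initial diameter is skipped; late windows are disjoint,
  so each turn has at most one task.\<close>

lemma winning2_finitely_many_zero_digits:
  assumes Q: "basic_sequence Q" and lim: "infinite_in_limit Q"
    and \<alpha>: "0 < \<alpha>" "\<alpha> < 1/2" and \<beta>: "0 < \<beta>" "\<beta> < 1"
  shows "winning2 \<alpha> \<beta> {x. \<exists>N. \<forall>n\<ge>N. cantor_digits Q x n \<noteq> 0}"
proof -
  define c where "c = \<alpha> * \<beta>"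
  have c: "0 < c" "c < 1"
    using \<alpha> \<beta> mult_strict_mono[of \<alpha> 1 \<beta> 1] by (auto simp: c_def)
  define h where "h n = 1 / digit_scale Q n / 2" for n
  have h_pos: "h n > 0" for n using digit_scale_pos[OF Q, of n] by (simp add: h_def)
  \<comment> \<open>This threshold serves twice: it is the bound in
    \<open>zero_digit_avoiding_reply\<close>, and as \<open>\<epsilon> < c\<close> it gives
    \<open>h (Suc n) < c * h n\<close>, which separates the windows.\<close>
  define \<epsilon> where "\<epsilon> = (1 - 2 * \<alpha>) * c / 2"
  have \<epsilon>: "0 < \<epsilon>" "\<epsilon> < c"
    using \<alpha> c mult_strict_right_mono[of "1 - 2 * \<alpha>" 2 c] by (auto simp: \<epsilon>_def)
  have "\<forall>\<^sub>F n in sequentially. 1 / real (Q n) < \<epsilon>"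
    by (rule order_tendstoD(2)[OF infinite_in_limit_inverse_tendsto_0[OF lim] \<epsilon>(1)])
  then obtain K where K: "\<And>n. n \<ge> K \<Longrightarrow> 1 / real (Q n) < \<epsilon>" unfolding eventually_sequentially by blast
  have h_step: "h (Suc n) < c * h n" if "n \<ge> K" for n
  proof -
    have "h (Suc n) = 1 / real (Q (Suc n)) * h n" by (simp add: h_def digit_scale_Suc)
    also have "\<dots> < c * h n" using K[of "Suc n"] that \<epsilon> h_pos[of n] by (intro mult_strict_right_mono) auto
    finally show ?thesis .
  qed
  have h_anti: "h m \<le> h n" if "n \<le> m" for m n
    using that
  proof (induction m rule: dec_induct)
    case (step m)
    have "h (Suc m) \<le> h m"
      using digit_scale_pos[OF Q, of m] basic_sequence_Suc[OF Q, of m]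
      by (simp add: h_def digit_scale_Suc field_simps)
    then show ?case using step by simp
  qed simp
  have scale_unique: "m = n" if "K \<le> m" "K \<le> n" "c * h m < L" "L \<le> h m" "c * h n < L" "L \<le> h n" for m n L
  proof -
    have "\<not> p < r" if "K \<le> p" "c * h p < L" "L \<le> h r" for p r
      using h_step[of p] h_anti[of "Suc p" r] that by (auto simp: Suc_le_eq)
    then show ?thesis using that by (meson linorder_neqE_nat)
  qed
  define good where "good I A \<longleftrightarrow> legal_move \<alpha> I A \<and>
      (\<forall>n\<ge>K. c * h n < diameter I \<and> diameter I \<le> h n \<longrightarrow> (\<forall>x\<in>A. cantor_digits Q x (Suc n) \<noteq> 0))" for I A
  have ex_good: "\<exists>A. good I A" if I: "closed_interval I" for I
  proof -
    obtain a b where ab: "a < b" "I = {a..b}" using I by (auto simp: closed_interval_def)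
    show ?thesis
    proof (cases "\<exists>n\<ge>K. c * h n < b - a \<and> b - a \<le> h n")
      case True
      then obtain n where n: "n \<ge> K" "c * h n < b - a" "b - a \<le> h n" by blast
      obtain A where A: "legal_move \<alpha> {a..b} A" "\<forall>x\<in>A. cantor_digits Q x (Suc n) \<noteq> 0"
        using zero_digit_avoiding_reply[OF Q \<alpha> c ab(1), of n] K[of "Suc n"] n
        by (auto simp: h_def \<epsilon>_def)
      have "good I A" unfolding good_def using ab A scale_unique[OF n(1) _ n(2,3)] by auto
      then show ?thesis ..
    next
      case False
      define l where "l = \<alpha> * (b - a)"
      have "0 < l" "l \<le> b - a" using \<alpha> ab by (auto simp: l_def mult_le_cancel_right1)
      then have "legal_move \<alpha> I {a..a + l}"
        unfolding legal_move_def closed_interval_def using ab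
        by (auto simp: radius_closed_interval simp flip: l_def)
      with False ab show ?thesis by (auto simp: good_def)
    qed
  qed
  \<comment> \<open>Whether a reply is \<open>good\<close> depends on Bob's latest interval alone,
    so the strategy needs no memory.\<close>
  define \<sigma> where "\<sigma> Bs = (SOME A. good (last Bs) A)" for Bs
  have move: "good (B n) (alice_move \<sigma> B n)" if "bob_legal_upto \<beta> \<sigma> B n" for B n
    unfolding alice_move_def \<sigma>_def
    using someI_ex[OF ex_good[OF bob_legal_upto_closed_interval[OF that]]] by simp
  have "x \<in> {x. \<exists>N. \<forall>n\<ge>N. cantor_digits Q x n \<noteq> 0}"
    if B: "\<And>n. bob_legal_upto \<beta> \<sigma> B n" and x: "x \<in> (\<Inter>n. B n)" for B x
  proof -
    have bob: "legal_move \<beta> (alice_move \<sigma> B t) (B (Suc t))" for t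
      using B[of "Suc t"] by (simp add: bob_legal_upto_def)
    have diam_Suc: "diameter (B (Suc t)) = c * diameter (B t)" for t
      using move[OF B, of t] bob[of t] by (simp add: good_def legal_move_def radius_def c_def)
    then have diam: "diameter (B t) = c ^ t * diameter (B 0)" for t
      by (induction t) auto
    have B0: "diameter (B 0) > 0"
      using bob_legal_upto_closed_interval[OF B, of 0] by (auto simp: closed_interval_def)
    have "(\<lambda>n. h n) \<longlonglongrightarrow> 0"
      unfolding h_def using tendsto_divide[OF inverse_digit_scale_tendsto_0[OF Q] tendsto_const, of 2] by simp
    then have "\<forall>\<^sub>F n in sequentially. h n < diameter (B 0)" using B0 by (intro order_tendstoD)
    then obtain M where M: "\<And>n. n \<ge> M \<Longrightarrow> h n < diameter (B 0)" unfolding eventually_sequentially by blast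
    have "cantor_digits Q x (Suc n) \<noteq> 0" if n: "n \<ge> M" "n \<ge> K" for n
    proof -
      have "(\<lambda>t. c ^ t * diameter (B 0)) \<longlonglongrightarrow> 0 * diameter (B 0)"
        using c by (intro tendsto_mult LIMSEQ_power_zero tendsto_const) auto
      moreover have "(\<lambda>t. diameter (B t)) = (\<lambda>t. c ^ t * diameter (B 0))" using diam by (rule ext)
      ultimately have "(\<lambda>t. diameter (B t)) \<longlonglongrightarrow> 0" by (simp only: mult_zero_left)
      then have "\<forall>\<^sub>F t in sequentially. diameter (B t) < h n"
        using h_pos[of n] by (rule order_tendstoD)
      then have ex: "\<exists>t. diameter (B t) \<le> h n"
        unfolding eventually_sequentially by (meson less_imp_le order_refl)
      \<comment> \<open>The initial diameter exceeds \<open>h n\<close> because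
        \<open>n \<ge> M\<close>, so this first turn has a predecessor. The diameter there is still
        above \<open>h n\<close>, which puts turn \<open>t\<close> inside the window.\<close>
      define t where "t = (LEAST t. diameter (B t) \<le> h n)"
      have t: "diameter (B t) \<le> h n" unfolding t_def by (rule LeastI_ex[OF ex])
      have "t \<noteq> 0" using t M[OF n(1)] by (metis not_le)
      then obtain s where s: "t = Suc s" by (cases t) auto
      have "\<not> diameter (B s) \<le> h n" using not_less_Least[of s "\<lambda>t. diameter (B t) \<le> h n"] s t_def by simp
      then have "c * h n < diameter (B t)" unfolding s diam_Suc using c by simp
      moreover have "x \<in> alice_move \<sigma> B t" using x bob[of t] by (auto simp: legal_move_def)
      ultimately show ?thesis using move[OF B, of t] t n by (auto simp: good_def)
    qed
    then have "cantor_digits Q x n \<noteq> 0" if "n \<ge> Suc (max M K)" for n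
      using that by (cases n) auto
    then show ?thesis by blast
  qed
  moreover have "legal_move \<alpha> (B n) (alice_move \<sigma> B n)" if "bob_legal_upto \<beta> \<sigma> B n" for B n
    using move[OF that] by (simp add: good_def)
  ultimately show ?thesis
    unfolding winning2_def by (intro exI[of _ \<sigma>]) blast
qed

section \<open>The winning dimension of the two complements\<close>

lemma windim_eq_half:
  assumes win: "\<And>\<alpha>. 0 < \<alpha> \<Longrightarrow> \<alpha> < 1/2 \<Longrightarrow> winning \<alpha> S" and S: "S \<noteq> UNIV"
  shows "windim S = 1/2"
  unfolding windim_def
proof (rule cSup_eq_non_empty)
  show "{\<alpha>. 0 < \<alpha> \<and> \<alpha> < 1 \<and> winning \<alpha> S} \<noteq> {}" using win[of "1/4"] by (auto intro!: exI[of _ "1/4"])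
  fix \<alpha> assume "\<alpha> \<in> {\<alpha>. 0 < \<alpha> \<and> \<alpha> < 1 \<and> winning \<alpha> S}"
  then show "\<alpha> \<le> 1/2" using not_winning_above_half[of \<alpha>] S by force
next
  fix u assume u: "\<And>\<alpha>. \<alpha> \<in> {\<alpha>. 0 < \<alpha> \<and> \<alpha> < 1 \<and> winning \<alpha> S} \<Longrightarrow> \<alpha> \<le> u"
  show "1/2 \<le> u"
  proof (rule dense_le_bounded[of 0])
    fix w :: real assume "0 < w" "w < 1/2"
    then show "w \<le> u" using u[of w] win[of w] by simp
  qed simp
qed

theorem theorem2p5:
  fixes Q :: "nat \<Rightarrow> nat"
  assumes "basic_sequence Q" and "infinite_in_limit Q"
  shows "windim (UNIV - RN2 Q) = 1/2 \<and>
         (one_divergent Q \<longrightarrow> windim (UNIV - N1 Q) = 1/2)"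
proof (intro conjI impI)
  \<comment> \<open>This set lies in both complements, so one strategy serves both claims.\<close>
  define Z where "Z = {x. \<exists>N. \<forall>n\<ge>N. cantor_digits Q x n \<noteq> 0}"
  have win: "winning \<alpha> S" if "0 < \<alpha>" "\<alpha> < 1/2" "Z \<subseteq> S" for \<alpha> S
    unfolding winning_def
    using winning2_mono[OF winning2_finitely_many_zero_digits[OF assms]] that unfolding Z_def by blast
  show "windim (UNIV - RN2 Q) = 1/2"
  proof (rule windim_eq_half)
    show "UNIV - RN2 Q \<noteq> UNIV" using RN2_nonempty[OF assms] by blast
    have "Z \<subseteq> UNIV - RN2 Q" using finitely_many_zero_digits_notin_RN2 by (auto simp: Z_def)
    then show "winning \<alpha> (UNIV - RN2 Q)" if "0 < \<alpha>" "\<alpha> < 1/2" for \<alpha> using win that by blast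
  qed
  assume div: "one_divergent Q"
  show "windim (UNIV - N1 Q) = 1/2"
  proof (rule windim_eq_half)
    show "UNIV - N1 Q \<noteq> UNIV" using N1_nonempty[OF assms div] by blast
    have "Z \<subseteq> UNIV - N1 Q" using finitely_many_zero_digits_notin_N1[OF div] by (auto simp: Z_def)
    then show "winning \<alpha> (UNIV - N1 Q)" if "0 < \<alpha>" "\<alpha> < 1/2" for \<alpha> using win that by blast
  qed
qed

end
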